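(* Let $\kappa_1,\kappa_2\in\mathbb{R}$ with $\kappa_1+4\kappa_2>0$. There exists a constant $C>0$, independent of $N$, $t$ and $\gamma$, such that for every even integer $N\ge 4$, with $\varepsilon=1/N$, every $t>0$ such that $\gamma:=t\sqrt{\kappa_1+4\kappa_2}$ satisfies $1\le\gamma\le N$ (the regime $t=\mathcal{O}(1)$), and every $n\in\{1,\dots,N\}$ with $n\ne N/2$ and $n\neq N/2-1$, the discrete gradient $Dy$ of the solution $y$ of the lattice problem described in the context satisfies \[ |D y(n,t)|\le C\frac{|\kappa_2|}{\kappa_1+4\kappa_2}\left(\sqrt{\frac{\varepsilon}{\gamma}}\,(1+\gamma)+\varepsilon\bigl(1+\varepsilon\gamma+\log(\gamma+2)\bigr)\right). \]
   Context: Let $N$ be an even integer and $\varepsilon=1/N$. The function $y(n,t)$, $n\in\mathbb{Z}$, $t\ge 0$, is the solution, $N$-periodic in $n$, of \[ \ddot y(n,t)-\frac{\kappa_1+4\kappa_2}{\varepsilon^2}\bigl[y(n-1,t)-2y(n,t)+y(n+1,t)\bigr]=f(n),\qquad y(n,0)=0,\quad \dot y(n,0)=0, \] where dots denote $t$-derivatives and $f$ (the "ghost force") is the $N$-periodic function with $f(N/2)=2\kappa_2/\varepsilon$, $f(N/2-1)=f(N/2+1)=-\kappa_2/\varepsilon$, and $f(n)=0$ for all other $n\in\{1,\dots,N\}$. The discrete gradient is $Dy(n,t)=\bigl(y(n+1,t)-y(n,t)\bigr)/\varepsilon$. $\log$ is the natural logarithm. *)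

theory Defs
  imports Complex_Main
begin

(* The residues n mod N range over {0..N-1} instead of {1..N}. For N >= 4 the three exceptional
   sites N/2 - 1, N/2, N/2 + 1 lie in both ranges, and the force vanishes at 0 and at N. *)
definition ghost_force :: "real \<Rightarrow> int \<Rightarrow> int \<Rightarrow> real" where
  "ghost_force \<kappa>2 N n =
     (let \<epsilon> = 1 / real_of_int N in
      if n mod N = N div 2 then 2 * \<kappa>2 / \<epsilon>
      else if n mod N = N div 2 - 1 \<or> n mod N = N div 2 + 1 then - \<kappa>2 / \<epsilon>
      else 0)"

(* y n t is only constrained for t >= 0; at t = 0 the time derivatives are one-sided.
   The witnesses v and a are the velocity and the acceleration. *)
definition lattice_solution :: "real \<Rightarrow> real \<Rightarrow> int \<Rightarrow> (int \<Rightarrow> real \<Rightarrow> real) \<Rightarrow> bool" where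
  "lattice_solution \<kappa>1 \<kappa>2 N y \<longleftrightarrow>
     (let \<epsilon> = 1 / real_of_int N in
      (\<forall>n. \<forall>t\<ge>0. y (n + N) t = y n t) \<and>
      (\<exists>v a :: int \<Rightarrow> real \<Rightarrow> real.
         (\<forall>n. \<forall>t\<ge>0.
            (y n has_real_derivative v n t) (at t within {0..}) \<and>
            (v n has_real_derivative a n t) (at t within {0..}) \<and>
            a n t - (\<kappa>1 + 4 * \<kappa>2) / \<epsilon>\<^sup>2 * (y (n - 1) t - 2 * y n t + y (n + 1) t)
              = ghost_force \<kappa>2 N n) \<and>
         (\<forall>n. y n 0 = 0 \<and> v n 0 = 0)))"

definition discrete_gradient :: "int \<Rightarrow> (int \<Rightarrow> real \<Rightarrow> real) \<Rightarrow> int \<Rightarrow> real \<Rightarrow> real" where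
  "discrete_gradient N y n t = (let \<epsilon> = 1 / real_of_int N in (y (n + 1) t - y n t) / \<epsilon>)"

end

theory Submission
  imports Defs
begin

text \<open>
  Write \<open>K = \<kappa>1 + 4 \<kappa>2\<close>. The ghost force is \<open>- \<kappa>2 N\<close> times the second difference of the
  unit mass at the site \<open>N / 2\<close> of the ring. Hence \<open>\<kappa>2 / (K N)\<close> times this mass is a stationary solution of
  the forced equation, and the solution that starts from rest at zero is
  \<open>y(n, t) = \<kappa>2 / (K N) \<cdot> (P(n - N/2, 0) - P(n - N/2, s))\<close> with \<open>s = sqrt K N t = N \<gamma>\<close>, where
  \<open>P(\<sqdot>, s)\<close> is the free wave on the ring that is released from rest as a unit mass at the origin.
  Away from the two excluded sites \<open>P(\<sqdot>, 0)\<close> contributes nothing to the gradient, so everything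
  reduces to \<open>\<bar>P(m + 1, s) - P(m, s)\<bar> \<le> C (1 + \<gamma>) / sqrt s\<close>; this is the first term of the claimed
  bound, and the remaining terms are nonnegative.

  With \<open>\<theta>\<^sub>k = \<pi> k / N\<close> the discrete Fourier representation turns the gradient of \<open>P\<close> into sums
  \<open>(1/N) \<Sum>\<^sub>k sin \<theta>\<^sub>k exp(i (p \<theta>\<^sub>k - 2 s sin \<theta>\<^sub>k))\<close> with \<open>\<bar>p\<bar> \<le> 2 N\<close>. The phase has second difference
  exactly \<open>\<mu> sin \<theta>\<^sub>k\<close>, where \<open>\<mu> = 8 s sin\<^sup>2(\<pi> / 2N)\<close> is of order \<open>s / N\<^sup>2\<close>: the weight is the curvature
  of the phase. This makes a van der Corput argument work without cutting off the ends of the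
  frequency range, where the curvature degenerates.

  The argument (\<open>exponential_sum_second_difference_weight\<close>): let \<open>x\<close> be the first difference of the
  phase. Away from \<open>2\<pi>\<int>\<close> one sums by parts, dividing by \<open>exp(i x) - 1\<close>; near \<open>2\<pi>\<int>\<close> one uses absolute
  values, and since the weight is the increment of \<open>x\<close>, the weights of the indices with \<open>x\<close> within \<open>\<delta>\<close>
  of a given multiple of \<open>2\<pi>\<close> add up to \<open>O(\<delta>)\<close>. A regularised reciprocal does both at once. With
  \<open>\<delta> = sqrt \<mu>\<close> every multiple of \<open>2\<pi>\<close> in the range of \<open>x\<close> costs \<open>O(sqrt \<mu>)\<close>, and there are
  \<open>O(1 + \<gamma>)\<close> of them; division by \<open>\<mu> N\<close> gives the bound.
\<close>

section \<open>Elementary trigonometric estimates\<close>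

lemma cmod_cis_minus_one: "cmod (cis x - 1) = 2 * \<bar>sin (x / 2)\<bar>"
proof -
  have c: "cos x = 1 - 2 * (sin (x / 2))\<^sup>2"
    using cos_double_sin[of "x / 2"] by simp
  have "(cmod (cis x - 1))\<^sup>2 = (cos x - 1)\<^sup>2 + (sin x)\<^sup>2"
    by (simp add: cmod_power2)
  also have "\<dots> = 2 - 2 * cos x"
    using sin_cos_squared_add[of x] by (simp add: power2_eq_square algebra_simps)
  also have "\<dots> = (2 * \<bar>sin (x / 2)\<bar>)\<^sup>2"
    unfolding c by (simp add: power_mult_distrib)
  finally show ?thesis
    using power2_eq_iff_nonneg[of "cmod (cis x - 1)" "2 * \<bar>sin (x / 2)\<bar>"] by simp
qed

lemma cmod_cis_diff_le: "cmod (cis a - cis b) \<le> \<bar>a - b\<bar>"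
proof -
  have "cis a - cis b = cis b * (cis (a - b) - 1)"
    by (simp add: cis_mult algebra_simps)
  hence "cmod (cis a - cis b) = 2 * \<bar>sin ((a - b) / 2)\<bar>"
    by (simp add: norm_mult cmod_cis_minus_one)
  also have "\<dots> \<le> \<bar>a - b\<bar>"
    using abs_sin_x_le_abs_x[of "(a - b) / 2"] by simp
  finally show ?thesis .
qed

lemma half_le_sin:
  fixes x :: real
  assumes "0 \<le> x" "x \<le> pi / 2"
  shows "x / 2 \<le> sin x"
proof -
  define y where "y = x / 2"
  have y: "0 \<le> y" "y \<le> pi / 4" "y \<le> 1"
    using assms pi_less_4 by (simp_all add: y_def)
  have "\<bar>sin y - y\<bar> \<le> inverse (fact 3) * \<bar>y\<bar> ^ 3"
    using Maclaurin_sin_bound[of y 3] by (simp add: sin_coeff_def eval_nat_numeral)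
  also have "\<dots> = y * y\<^sup>2 / 6"
    using y by (simp add: power3_eq_cube power2_eq_square fact_numeral)
  also have "\<dots> \<le> y * 1 / 6"
    using y by (intro divide_right_mono mult_left_mono power_le_one) auto
  finally have sin_y: "5 / 6 * y \<le> sin y" using abs_ge_minus_self[of "sin y - y"] by linarith
  have "7 / 10 \<le> sqrt 2 / 2"
    using real_le_rsqrt[of "14 / 10" 2] by (simp add: power2_eq_square)
  also have "\<dots> = cos (pi / 4)" by (simp add: cos_45)
  also have "\<dots> \<le> cos y" using y by (intro cos_monotone_0_pi_le) auto
  finally have "(5 / 6 * y) * (7 / 10) \<le> sin y * cos y"
    using sin_y y by (intro mult_mono) auto
  moreover have "sin x = 2 * (sin y * cos y)"
    using sin_double[of y] by (simp add: y_def)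
  ultimately show ?thesis using y(1) by (simp add: y_def)
qed

lemma sin_diff_step: "sin (a + 2 * h) - sin a = 2 * sin h * cos (a + h)" for a h :: real
proof -
  have "(a + 2 * h - a) / 2 = h" "(a + 2 * h + a) / 2 = a + h" by simp_all
  thus ?thesis by (simp only: sin_diff_sin)
qed

lemma cos_diff_step: "cos (a + 2 * h) - cos a = - (2 * sin h * sin (a + h))" for a h :: real
proof -
  have "(a - (a + 2 * h)) / 2 = - h" "(a + 2 * h + a) / 2 = a + h" by simp_all
  thus ?thesis by (simp only: cos_diff_cos sin_minus) simp
qed

section \<open>Exponential sums weighted by the second difference of the phase\<close>

lemma sum_by_parts:
  fixes G E :: "nat \<Rightarrow> complex"
  shows "(\<Sum>k<Suc n. G k * (E (Suc k) - E k))
       = G n * E (Suc n) - G 0 * E 0 - (\<Sum>k<n. (G (Suc k) - G k) * E (Suc k))"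
  by (induction n) (simp_all add: algebra_simps)

text \<open>
  A bounded substitute for \<open>1 / z\<close>. The part that \<open>reg_inv \<delta> z * z\<close> misses of \<open>1\<close> is \<open>reg_defect \<delta> z\<close>,
  a bump of width \<open>\<delta>\<close> around \<open>z = 0\<close>.
\<close>

definition reg_inv :: "real \<Rightarrow> complex \<Rightarrow> complex" where
  "reg_inv \<delta> z = cnj z / of_real ((cmod z)\<^sup>2 + \<delta>\<^sup>2)"

definition reg_defect :: "real \<Rightarrow> complex \<Rightarrow> real" where
  "reg_defect \<delta> z = \<delta>\<^sup>2 / ((cmod z)\<^sup>2 + \<delta>\<^sup>2)"

lemma reg_inv_mult:
  assumes "\<delta> > 0"
  shows "reg_inv \<delta> z * z + of_real (reg_defect \<delta> z) = 1"
proof -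
  have "(cmod z)\<^sup>2 + \<delta>\<^sup>2 > 0"
    using assms by (simp add: add_nonneg_pos)
  hence nz: "of_real ((cmod z)\<^sup>2 + \<delta>\<^sup>2) \<noteq> (0 :: complex)"
    by (metis of_real_eq_0_iff less_irrefl)
  have "cnj z * z = of_real ((cmod z)\<^sup>2)"
    by (simp only: complex_norm_square mult.commute)
  hence "reg_inv \<delta> z * z + of_real (reg_defect \<delta> z)
       = of_real ((cmod z)\<^sup>2 + \<delta>\<^sup>2) / of_real ((cmod z)\<^sup>2 + \<delta>\<^sup>2)"
    unfolding reg_inv_def reg_defect_def of_real_add of_real_divide add_divide_distrib by simp
  thus ?thesis using nz by simp
qed

lemma norm_reg_inv_le:
  assumes "\<delta> > 0"
  shows "cmod (reg_inv \<delta> z) \<le> 1 / (2 * \<delta>)"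
proof -
  have pos: "(cmod z)\<^sup>2 + \<delta>\<^sup>2 > 0"
    using assms by (simp add: add_nonneg_pos)
  have "2 * \<delta> * cmod z \<le> (cmod z)\<^sup>2 + \<delta>\<^sup>2"
    using sum_squares_bound[of "cmod z" \<delta>] by (simp add: algebra_simps)
  hence "cmod z / ((cmod z)\<^sup>2 + \<delta>\<^sup>2) \<le> 1 / (2 * \<delta>)"
    using assms pos by (simp add: divide_simps mult_ac)
  moreover have "cmod (reg_inv \<delta> z) = cmod z / ((cmod z)\<^sup>2 + \<delta>\<^sup>2)"
    unfolding reg_inv_def norm_divide norm_of_real using pos by simp
  ultimately show ?thesis by simp
qed

text \<open>
  The defect controls not only the error of the regularised reciprocal but also its variation.
  Both contributions to the exponential sum are therefore Riemann sums of the same bump. The middle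
  step is the arithmetic-geometric mean inequality.
\<close>

lemma norm_reg_inv_diff_le:
  assumes "\<delta> > 0"
  shows "cmod (reg_inv \<delta> z - reg_inv \<delta> w)
     \<le> cmod (z - w) * (reg_defect \<delta> z + reg_defect \<delta> w) / (2 * \<delta>\<^sup>2)"
proof -
  define p where "p = (cmod z)\<^sup>2 + \<delta>\<^sup>2"
  define q where "q = (cmod w)\<^sup>2 + \<delta>\<^sup>2"
  have pos: "p > 0" "q > 0"
    unfolding p_def q_def using assms by (simp_all add: add_nonneg_pos)
  have nz: "of_real p \<noteq> (0::complex)" "of_real q \<noteq> (0::complex)"
    using pos by simp_all
  have e: "of_real p = z * cnj z + of_real (\<delta>\<^sup>2)" "of_real q = w * cnj w + of_real (\<delta>\<^sup>2)"
    unfolding p_def q_def of_real_add by (simp_all only: complex_norm_square)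
  have "cnj z * of_real q - cnj w * of_real p
      = cnj z * cnj w * (w - z) + of_real (\<delta>\<^sup>2) * cnj (z - w)"
    unfolding e by (simp add: algebra_simps)
  hence "reg_inv \<delta> z - reg_inv \<delta> w
      = (cnj z * cnj w * (w - z) + of_real (\<delta>\<^sup>2) * cnj (z - w)) / (of_real p * of_real q)"
    unfolding reg_inv_def p_def[symmetric] q_def[symmetric] using nz
    by (simp add: diff_frac_eq)
  hence "cmod (reg_inv \<delta> z - reg_inv \<delta> w)
      = cmod (cnj z * cnj w * (w - z) + of_real (\<delta>\<^sup>2) * cnj (z - w)) / (p * q)"
    using pos by (simp add: norm_divide norm_mult)
  also have "\<dots> \<le> cmod (z - w) * (cmod z * cmod w + \<delta>\<^sup>2) / (p * q)"
  proof (rule divide_right_mono)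
    have "cmod (cnj z * cnj w * (w - z) + of_real (\<delta>\<^sup>2) * cnj (z - w))
        \<le> cmod (cnj z * cnj w * (w - z)) + cmod (of_real (\<delta>\<^sup>2) * cnj (z - w))"
      by (rule norm_triangle_ineq)
    also have "\<dots> = cmod z * cmod w * cmod (w - z) + \<delta>\<^sup>2 * cmod (z - w)"
      unfolding norm_mult norm_of_real complex_mod_cnj by simp
    finally show "cmod (cnj z * cnj w * (w - z) + of_real (\<delta>\<^sup>2) * cnj (z - w))
        \<le> cmod (z - w) * (cmod z * cmod w + \<delta>\<^sup>2)"
      by (simp add: norm_minus_commute algebra_simps)
  qed (use pos in simp)
  also have "\<dots> \<le> cmod (z - w) * ((p + q) / 2) / (p * q)"
  proof (intro divide_right_mono mult_left_mono)
    show "cmod z * cmod w + \<delta>\<^sup>2 \<le> (p + q) / 2"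
      unfolding p_def q_def using sum_squares_bound[of "cmod z" "cmod w"] by simp
  qed (use pos in simp_all)
  also have "\<dots> = cmod (z - w) * (reg_defect \<delta> z + reg_defect \<delta> w) / (2 * \<delta>\<^sup>2)"
    unfolding reg_defect_def p_def[symmetric] q_def[symmetric]
    using pos assms by (simp add: field_simps)
  finally show ?thesis .
qed

lemma reg_defect_nonneg: "reg_defect \<delta> z \<ge> 0"
  unfolding reg_defect_def by simp

lemma reg_defect_cis_le:
  assumes "\<delta> > 0" "\<bar>x - 2 * pi * of_int j\<bar> \<le> pi"
  shows "reg_defect \<delta> (cis x - 1) \<le> 4 / (1 + ((x - 2 * pi * of_int j) / \<delta>)\<^sup>2)"
proof -
  define d where "d = x - 2 * pi * of_int j"
  have "cis d = cis x * cis (- (2 * pi * of_int j))"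
    unfolding cis_mult d_def by simp
  also have "cis (- (2 * pi * of_int j)) = 1"
    by (intro complex_eqI)
       (use cos_int_2pin[of j] sin_int_2pin[of j] in simp_all)
  finally have norm_eq: "cmod (cis x - 1) = 2 * \<bar>sin (d / 2)\<bar>"
    by (simp flip: cmod_cis_minus_one)
  have "\<bar>d\<bar> / 4 \<le> \<bar>sin (d / 2)\<bar>"
  proof -
    have "\<bar>d\<bar> / 4 \<le> sin (\<bar>d\<bar> / 2)"
      using half_le_sin[of "\<bar>d\<bar> / 2"] assms(2) by (simp add: d_def)
    also have "\<dots> \<le> \<bar>sin (d / 2)\<bar>" by (cases "d \<ge> 0") simp_all
    finally show ?thesis .
  qed
  hence "\<bar>d\<bar> / 2 \<le> cmod (cis x - 1)" using norm_eq by linarith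
  hence "(\<bar>d\<bar> / 2)\<^sup>2 \<le> (cmod (cis x - 1))\<^sup>2" by (intro power_mono) auto
  hence *: "d\<^sup>2 \<le> 4 * (cmod (cis x - 1))\<^sup>2" by (simp add: power_divide)
  have "reg_defect \<delta> (cis x - 1) \<le> 4 * \<delta>\<^sup>2 / (\<delta>\<^sup>2 + d\<^sup>2)"
  proof -
    have "\<delta>\<^sup>2 * (\<delta>\<^sup>2 + d\<^sup>2) \<le> \<delta>\<^sup>2 * (4 * ((cmod (cis x - 1))\<^sup>2 + \<delta>\<^sup>2))"
    proof (rule mult_left_mono)
      show "\<delta>\<^sup>2 + d\<^sup>2 \<le> 4 * ((cmod (cis x - 1))\<^sup>2 + \<delta>\<^sup>2)"
        using * zero_le_power2[of \<delta>] unfolding distrib_left by linarith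
    qed simp
    moreover have "\<delta>\<^sup>2 + d\<^sup>2 > 0" "(cmod (cis x - 1))\<^sup>2 + \<delta>\<^sup>2 > 0"
      using assms(1) by (simp_all add: add_nonneg_pos add_pos_nonneg)
    ultimately show ?thesis
      unfolding reg_defect_def by (simp add: divide_simps) (simp add: algebra_simps)
  qed
  also have "\<dots> = 4 / (1 + (d / \<delta>)\<^sup>2)"
    using assms(1) by (simp add: field_simps power_divide)
  finally show ?thesis unfolding d_def .
qed

text \<open>
  A Riemann sum of \<open>1 / (1 + \<xi>\<^sup>2)\<close> is dominated by a telescoping sum: as long as the steps are bounded,
  the integrand changes by at most a constant factor over one step.
\<close>

lemma arctan_increment_ge:
  fixes u v \<xi> :: real
  assumes "u \<le> \<xi>" "\<xi> \<le> v" "v - u \<le> 6"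
  shows "(v - u) / (1 + \<xi>\<^sup>2) \<le> 73 * (arctan v - arctan u)"
proof (cases "u < v")
  case True
  obtain z where z: "u < z" "z < v" "arctan v - arctan u = (v - u) * inverse (1 + z\<^sup>2)"
    using MVT2[OF True, of arctan "\<lambda>x. inverse (1 + x\<^sup>2)"] DERIV_arctan by blast
  have "z\<^sup>2 \<le> (\<bar>\<xi>\<bar> + 6)\<^sup>2"
    using z assms by (intro abs_le_square_iff[THEN iffD1]) auto
  also have "\<dots> \<le> 2 * \<xi>\<^sup>2 + 72"
    using sum_squares_bound[of "\<bar>\<xi>\<bar>" 6] by (simp add: power2_sum)
  finally have "1 + z\<^sup>2 \<le> 73 * (1 + \<xi>\<^sup>2)"
    using zero_le_power2[of \<xi>] unfolding distrib_left by linarith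
  hence "1 / (1 + \<xi>\<^sup>2) \<le> 73 * inverse (1 + z\<^sup>2)"
    by (simp add: divide_simps add_pos_nonneg)
  hence "(v - u) * (1 / (1 + \<xi>\<^sup>2)) \<le> (v - u) * (73 * inverse (1 + z\<^sup>2))"
    using True by (intro mult_left_mono) auto
  thus ?thesis using z by simp
next
  case False
  hence "u = v" using assms by linarith
  thus ?thesis by simp
qed

text \<open>
  Around each multiple \<open>2 \<pi> j\<close> the bump is at most \<open>4 / (1 + ((x - 2 \<pi> j) / \<delta>)\<^sup>2)\<close>, whose primitive has
  total variation \<open>4 \<pi> \<delta>\<close>. The points \<open>x k\<close> increase, so each of the \<open>2 M + 1\<close> multiples within reach
  is passed only once and the constant is \<open>4 * 73 * \<pi>\<close>, with the factor of the previous lemma. The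
  evaluation points \<open>\<xi> k\<close> are kept free because both end points of the steps occur below.
\<close>

lemma sum_reg_defect_le:
  fixes x \<xi> :: "nat \<Rightarrow> real" and M :: nat
  assumes "\<delta> > 0"
    and step: "\<And>k. k < n \<Longrightarrow> x k \<le> \<xi> k \<and> \<xi> k \<le> x (Suc k) \<and> x (Suc k) - x k \<le> 6 * \<delta>"
    and range: "\<And>k. k < n \<Longrightarrow> \<bar>\<xi> k\<bar> \<le> 2 * pi * M"
  shows "(\<Sum>k<n. (x (Suc k) - x k) * reg_defect \<delta> (cis (\<xi> k) - 1))
       \<le> 292 * pi * \<delta> * (2 * M + 1)"
proof -
  define a where "a j t = arctan ((t - 2 * pi * of_int j) / \<delta>)" for j :: int and t
  define J where "J = {- int M..int M}"
  have "(x (Suc k) - x k) * reg_defect \<delta> (cis (\<xi> k) - 1)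
      \<le> 292 * \<delta> * (\<Sum>j\<in>J. a j (x (Suc k)) - a j (x k))" if k: "k < n" for k
  proof -
    \<comment> \<open>The multiple of \<open>2 \<pi>\<close> that is closest to \<open>\<xi> k\<close>.\<close>
    define j where "j = round (\<xi> k / (2 * pi))"
    have jd: "\<bar>of_int j - \<xi> k / (2 * pi)\<bar> \<le> 1 / 2"
      unfolding j_def by (rule of_int_round_abs_le)
    have "\<xi> k - 2 * pi * of_int j = - (of_int j - \<xi> k / (2 * pi)) * (2 * pi)"
      by (simp add: field_simps)
    hence "\<bar>\<xi> k - 2 * pi * of_int j\<bar> = \<bar>of_int j - \<xi> k / (2 * pi)\<bar> * (2 * pi)"
      by (simp add: abs_mult)
    also have "\<dots> \<le> (1 / 2) * (2 * pi)" using jd by (intro mult_right_mono) auto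
    finally have near: "\<bar>\<xi> k - 2 * pi * of_int j\<bar> \<le> pi" by simp
    have "\<bar>\<xi> k / (2 * pi)\<bar> \<le> M"
      using range[OF k] by (simp add: abs_mult divide_simps mult_ac)
    hence "\<bar>of_int j :: real\<bar> \<le> M + 1 / 2" using jd by linarith
    hence "\<bar>j\<bar> \<le> int M" by linarith
    hence jJ: "j \<in> J" unfolding J_def by auto
    let ?u = "(x k - 2 * pi * of_int j) / \<delta>" and ?v = "(x (Suc k) - 2 * pi * of_int j) / \<delta>"
      and ?w = "(\<xi> k - 2 * pi * of_int j) / \<delta>"
    have uv: "?v - ?u = (x (Suc k) - x k) / \<delta>" by (simp add: diff_divide_distrib)
    have "(?v - ?u) / (1 + ?w\<^sup>2) \<le> 73 * (arctan ?v - arctan ?u)"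
    proof (rule arctan_increment_ge)
      show "?u \<le> ?w" "?w \<le> ?v" using step[OF k] assms(1) by (simp_all add: divide_right_mono)
      show "?v - ?u \<le> 6" unfolding uv using step[OF k] assms(1) by (simp add: divide_simps)
    qed
    hence "4 * \<delta> * ((?v - ?u) / (1 + ?w\<^sup>2)) \<le> 4 * \<delta> * (73 * (arctan ?v - arctan ?u))"
      using assms(1) by (intro mult_left_mono) auto
    moreover have "4 * \<delta> * ((?v - ?u) / (1 + ?w\<^sup>2)) = (x (Suc k) - x k) * (4 / (1 + ?w\<^sup>2))"
      unfolding uv using assms(1) by simp
    ultimately have 1: "(x (Suc k) - x k) * (4 / (1 + ?w\<^sup>2))
        \<le> 292 * \<delta> * (a j (x (Suc k)) - a j (x k))"
      unfolding a_def by (simp only: mult.assoc[symmetric] mult.commute[of "4 * \<delta>" 73])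
    have "(x (Suc k) - x k) * reg_defect \<delta> (cis (\<xi> k) - 1)
        \<le> (x (Suc k) - x k) * (4 / (1 + ?w\<^sup>2))"
      using step[OF k] by (intro mult_left_mono reg_defect_cis_le assms(1) near) auto
    also note 1
    also have "292 * \<delta> * (a j (x (Suc k)) - a j (x k))
        \<le> 292 * \<delta> * (\<Sum>j\<in>J. a j (x (Suc k)) - a j (x k))"
    proof (intro mult_left_mono member_le_sum jJ)
      show "0 \<le> a i (x (Suc k)) - a i (x k)" for i
        unfolding a_def using step[OF k] assms(1) by (simp add: arctan_le_iff divide_right_mono)
    qed (use assms(1) in \<open>auto simp: J_def\<close>)
    finally show ?thesis .
  qed
  hence "(\<Sum>k<n. (x (Suc k) - x k) * reg_defect \<delta> (cis (\<xi> k) - 1))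
      \<le> (\<Sum>k<n. 292 * \<delta> * (\<Sum>j\<in>J. a j (x (Suc k)) - a j (x k)))"
    by (intro sum_mono) auto
  also have "\<dots> = 292 * \<delta> * (\<Sum>j\<in>J. \<Sum>k<n. a j (x (Suc k)) - a j (x k))"
    unfolding sum_distrib_left[symmetric] by (subst sum.swap) simp
  also have "\<dots> = 292 * \<delta> * (\<Sum>j\<in>J. a j (x n) - a j (x 0))"
    by (simp add: sum_lessThan_telescope[of "\<lambda>k. a _ (x k)"])
  also have "\<dots> \<le> 292 * \<delta> * (\<Sum>j\<in>J. pi)"
  proof (intro mult_left_mono sum_mono)
    show "a j (x n) - a j (x 0) \<le> pi" for j
      unfolding a_def using arctan_bounded[of "(x n - 2 * pi * of_int j) / \<delta>"]
        arctan_bounded[of "(x 0 - 2 * pi * of_int j) / \<delta>"] by linarith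
  qed (use assms(1) in auto)
  also have "\<dots> = 292 * pi * \<delta> * (2 * M + 1)"
    by (simp add: J_def algebra_simps)
  finally show ?thesis .
qed

text \<open>
  A van der Corput estimate. Its left side is a discrete version of \<open>\<integral> exp(i \<phi>) d(\<phi>')\<close>. Since
  \<open>cis (\<phi> (k + 2)) - cis (\<phi> (k + 1)) = cis (\<phi> (k + 1)) * (cis (x (k + 1)) - 1)\<close>, the regularised
  reciprocal at \<open>z = cis (x (k + 1)) - 1\<close> writes each term as a multiple of a difference of
  consecutive exponentials, plus an error. The error is a Riemann sum of the bump. Summation by parts
  turns the rest into the variation of \<open>w k * reg_inv \<delta> z\<close>: the variation of \<open>w\<close> costs \<open>V / (2 \<delta>)\<close>,
  and that of \<open>reg_inv\<close>, multiplied by \<open>w k \<le> \<delta>\<^sup>2\<close>, is again a Riemann sum of the bump.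
\<close>

lemma exponential_sum_second_difference_weight:
  fixes \<phi> x w :: "nat \<Rightarrow> real" and M :: nat
  assumes first_difference: "\<And>k. \<phi> (Suc k) = \<phi> k + x k"
    and second_difference: "\<And>k. x (Suc k) = x k + w k"
    and \<delta>: "0 < \<delta>" "\<delta> \<le> 6"
    and step: "\<And>k. k \<le> n \<Longrightarrow> 0 \<le> w k \<and> w k \<le> \<delta>\<^sup>2"
    and range: "\<And>k. k \<le> Suc n \<Longrightarrow> \<bar>x k\<bar> \<le> 2 * pi * M"
    and var: "(\<Sum>k<n. \<bar>w (Suc k) - w k\<bar>) \<le> V"
  shows "cmod (\<Sum>k<Suc n. of_real (w k) * cis (\<phi> (Suc k)))
       \<le> 584 * pi * \<delta> * (2 * M + 1) + \<delta> + V / (2 * \<delta>)"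
proof -
  have w_eq: "w k = x (Suc k) - x k" for k
    using second_difference[of k] by simp
  define g where "g k = reg_inv \<delta> (cis (x k) - 1)" for k
  define b where "b k = reg_defect \<delta> (cis (x k) - 1)" for k
  define E where "E k = cis (\<phi> (Suc k))" for k
  define G where "G k = of_real (w k) * g (Suc k)" for k
  define R where "R = 292 * pi * \<delta> * (2 * M + 1)"
  have step6: "w k \<le> 6 * \<delta>" if "k \<le> n" for k
  proof -
    have "w k \<le> \<delta> * \<delta>" using step[OF that] by (simp add: power2_eq_square)
    also have "\<dots> \<le> 6 * \<delta>" using \<delta> by (intro mult_right_mono) auto
    finally show ?thesis .
  qed
  have nE: "cmod (E k) = 1" for k by (simp add: E_def)
  have b0: "b k \<ge> 0" for k by (simp add: b_def reg_defect_nonneg)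
  have g_le: "cmod (g k) \<le> 1 / (2 * \<delta>)" for k
    unfolding g_def by (rule norm_reg_inv_le[OF \<delta>(1)])
  have R_left: "(\<Sum>k<Suc n. w k * b k) \<le> R"
    unfolding w_eq b_def R_def
    by (rule sum_reg_defect_le[OF \<delta>(1)])
       (use step step6 range in \<open>auto simp: w_eq less_Suc_eq_le\<close>)
  have R_right: "(\<Sum>k<Suc n. w k * b (Suc k)) \<le> R"
    unfolding w_eq b_def R_def
    by (rule sum_reg_defect_le[OF \<delta>(1)])
       (use step step6 range in \<open>auto simp: w_eq less_Suc_eq_le\<close>)
  have G_le: "cmod (G k) \<le> \<delta> / 2" if "k \<le> n" for k
  proof -
    have "cmod (G k) = w k * cmod (g (Suc k))"
      unfolding G_def norm_mult norm_of_real using step[OF that] by simp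
    also have "\<dots> \<le> \<delta>\<^sup>2 * (1 / (2 * \<delta>))"
      using step[OF that] g_le by (intro mult_mono) auto
    also have "\<dots> = \<delta> / 2" using \<delta> by (simp add: power2_eq_square)
    finally show ?thesis .
  qed
  have split: "of_real (w k) * E k = of_real (w k * b (Suc k)) * E k + G k * (E (Suc k) - E k)" for k
  proof -
    have "E (Suc k) = E k * cis (x (Suc k))"
      unfolding E_def cis_mult using first_difference[of "Suc k"] by simp
    hence "E (Suc k) - E k = E k * (cis (x (Suc k)) - 1)" by (simp add: algebra_simps)
    hence "of_real (w k * b (Suc k)) * E k + G k * (E (Suc k) - E k)
        = of_real (w k) * E k * (g (Suc k) * (cis (x (Suc k)) - 1) + of_real (b (Suc k)))"
      unfolding G_def by (simp add: algebra_simps)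
    also have "g (Suc k) * (cis (x (Suc k)) - 1) + of_real (b (Suc k)) = 1"
      unfolding g_def b_def by (rule reg_inv_mult[OF \<delta>(1)])
    finally show ?thesis by simp
  qed
  have G_diff: "cmod (G (Suc k) - G k)
      \<le> \<bar>w (Suc k) - w k\<bar> / (2 * \<delta>) + (w (Suc k) * b (Suc (Suc k)) + w (Suc k) * b (Suc k)) / 2"
    if k: "k < n" for k
  proof -
    have ww: "0 \<le> w k" "w k \<le> \<delta>\<^sup>2" "0 \<le> w (Suc k)" using step[of k] step[of "Suc k"] k by auto
    have "cmod (g (Suc (Suc k)) - g (Suc k))
        \<le> cmod (cis (x (Suc (Suc k))) - cis (x (Suc k))) * (b (Suc (Suc k)) + b (Suc k)) / (2 * \<delta>\<^sup>2)"
      using norm_reg_inv_diff_le[OF \<delta>(1), of "cis (x (Suc (Suc k))) - 1" "cis (x (Suc k)) - 1"]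
      unfolding g_def b_def by simp
    also have "\<dots> \<le> w (Suc k) * (b (Suc (Suc k)) + b (Suc k)) / (2 * \<delta>\<^sup>2)"
      using cmod_cis_diff_le[of "x (Suc (Suc k))" "x (Suc k)"] ww b0
      unfolding w_eq by (intro divide_right_mono mult_right_mono) (auto simp: add_nonneg_nonneg)
    finally have gd: "cmod (g (Suc (Suc k)) - g (Suc k))
        \<le> w (Suc k) * (b (Suc (Suc k)) + b (Suc k)) / (2 * \<delta>\<^sup>2)" .
    have "G (Suc k) - G k = of_real (w (Suc k) - w k) * g (Suc (Suc k))
        + of_real (w k) * (g (Suc (Suc k)) - g (Suc k))"
      unfolding G_def by (simp add: algebra_simps)
    hence "cmod (G (Suc k) - G k) \<le> cmod (of_real (w (Suc k) - w k) * g (Suc (Suc k)))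
        + cmod (of_real (w k) * (g (Suc (Suc k)) - g (Suc k)))"
      by (metis norm_triangle_ineq)
    also have "\<dots> = \<bar>w (Suc k) - w k\<bar> * cmod (g (Suc (Suc k)))
        + w k * cmod (g (Suc (Suc k)) - g (Suc k))"
      unfolding norm_mult norm_of_real using ww by simp
    also have "\<dots> \<le> \<bar>w (Suc k) - w k\<bar> * (1 / (2 * \<delta>))
        + \<delta>\<^sup>2 * (w (Suc k) * (b (Suc (Suc k)) + b (Suc k)) / (2 * \<delta>\<^sup>2))"
      using gd g_le ww by (intro add_mono mult_mono) auto
    also have "\<dots> = \<bar>w (Suc k) - w k\<bar> / (2 * \<delta>)
        + (w (Suc k) * b (Suc (Suc k)) + w (Suc k) * b (Suc k)) / 2"
      using \<delta> by (simp add: field_simps)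
    finally show ?thesis .
  qed
  have "(\<Sum>k<n. cmod (G (Suc k) - G k))
      \<le> (\<Sum>k<n. \<bar>w (Suc k) - w k\<bar> / (2 * \<delta>) + (w (Suc k) * b (Suc (Suc k)) + w (Suc k) * b (Suc k)) / 2)"
    using G_diff by (intro sum_mono) auto
  also have "\<dots> = (\<Sum>k<n. \<bar>w (Suc k) - w k\<bar>) / (2 * \<delta>)
      + ((\<Sum>k<n. w (Suc k) * b (Suc (Suc k))) + (\<Sum>k<n. w (Suc k) * b (Suc k))) / 2"
    by (simp add: sum.distrib sum_divide_distrib add_divide_distrib)
  also have "\<dots> \<le> V / (2 * \<delta>) + (R + R) / 2"
  proof (intro add_mono divide_right_mono var)
    have "(\<Sum>k<n. w (Suc k) * b (Suc (Suc k))) \<le> (\<Sum>k<Suc n. w k * b (Suc k))"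
      unfolding sum.lessThan_Suc_shift using step[of 0] b0 by simp
    thus "(\<Sum>k<n. w (Suc k) * b (Suc (Suc k))) \<le> R" using R_right by linarith
    have "(\<Sum>k<n. w (Suc k) * b (Suc k)) \<le> (\<Sum>k<Suc n. w k * b k)"
      unfolding sum.lessThan_Suc_shift using step[of 0] b0 by simp
    thus "(\<Sum>k<n. w (Suc k) * b (Suc k)) \<le> R" using R_left by linarith
  qed (use \<delta> in auto)
  finally have G_var: "(\<Sum>k<n. cmod (G (Suc k) - G k)) \<le> V / (2 * \<delta>) + R" by simp
  have "cmod (\<Sum>k<Suc n. G k * (E (Suc k) - E k))
      \<le> cmod (G n * E (Suc n)) + cmod (G 0 * E 0) + cmod (\<Sum>k<n. (G (Suc k) - G k) * E (Suc k))"
    unfolding sum_by_parts by (intro norm_triangle_le_diff add_mono order.refl norm_triangle_ineq4)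
  also have "\<dots> \<le> \<delta> / 2 + \<delta> / 2 + (V / (2 * \<delta>) + R)"
  proof (intro add_mono)
    show "cmod (\<Sum>k<n. (G (Suc k) - G k) * E (Suc k)) \<le> V / (2 * \<delta>) + R"
      by (rule order_trans[OF norm_sum]) (use G_var in \<open>simp add: norm_mult nE\<close>)
  qed (use G_le in \<open>simp_all add: norm_mult nE\<close>)
  finally have part2: "cmod (\<Sum>k<Suc n. G k * (E (Suc k) - E k)) \<le> \<delta> + V / (2 * \<delta>) + R" by simp
  have "cmod (\<Sum>k<Suc n. of_real (w k * b (Suc k)) * E k)
      \<le> (\<Sum>k<Suc n. cmod (of_real (w k * b (Suc k)) * E k))"
    by (rule norm_sum)
  also have "\<dots> = (\<Sum>k<Suc n. w k * b (Suc k))"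
    by (intro sum.cong refl, unfold norm_mult norm_of_real nE)
       (use step b0 in \<open>simp add: abs_mult less_Suc_eq_le\<close>)
  also note R_right
  finally have part1: "cmod (\<Sum>k<Suc n. of_real (w k * b (Suc k)) * E k) \<le> R" .
  have "(\<Sum>k<Suc n. of_real (w k) * cis (\<phi> (Suc k)))
      = (\<Sum>k<Suc n. of_real (w k * b (Suc k)) * E k) + (\<Sum>k<Suc n. G k * (E (Suc k) - E k))"
    unfolding E_def[symmetric] sum.distrib[symmetric] by (intro sum.cong refl split)
  hence "cmod (\<Sum>k<Suc n. of_real (w k) * cis (\<phi> (Suc k))) \<le> R + (\<delta> + V / (2 * \<delta>) + R)"
    by (simp only: norm_triangle_le[OF add_mono[OF part1 part2]])
  thus ?thesis unfolding R_def by simp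
qed

section \<open>The exponential sum of the ring\<close>

text \<open>
  The second difference of the phase is \<open>\<mu> * sin (\<theta> k)\<close>, so the van der Corput estimate with \<open>\<delta> = sqrt \<mu>\<close>
  bounds \<open>\<mu>\<close> times the sum by \<open>O(\<delta> (1 + s / N))\<close>. The first difference of the phase has modulus at most
  \<open>\<pi> \<bar>p\<bar> / N + 2 \<pi> s / N\<close>, which explains the factor \<open>1 + s / N\<close>. The assumption \<open>s \<le> N\<^sup>2\<close> gives
  \<open>\<mu> \<le> 2 \<pi>\<^sup>2\<close>, hence \<open>\<delta> \<le> 6\<close>.
\<close>

lemma sine_weighted_exponential_sum:
  fixes N :: nat and p s :: real
  defines "\<theta> \<equiv> \<lambda>k. pi * real k / real N"
  assumes N: "N \<ge> 2" and s: "0 < s" "s \<le> (real N)\<^sup>2" and p: "\<bar>p\<bar> \<le> 2 * real N"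
  shows "cmod (\<Sum>k<N. of_real (sin (\<theta> k)) * cis (p * \<theta> k - 2 * s * sin (\<theta> k)))
       \<le> 12000 * (1 + s / N) * (N / sqrt s)"
proof -
  \<comment> \<open>The term with \<open>k = 0\<close> vanishes; \<open>n\<close> is chosen so that the remaining indices are \<open>1, \<dots>, n + 1\<close>.\<close>
  obtain n where n: "N = Suc (Suc n)" using N by (metis Suc_le_D numeral_2_eq_2 Suc_le_mono)
  define h where "h = pi / (2 * real N)"
  define \<mu> where "\<mu> = 8 * s * (sin h)\<^sup>2"
  define \<delta> where "\<delta> = sqrt \<mu>"
  define \<phi> where "\<phi> k = p * \<theta> k - 2 * s * sin (\<theta> k)" for k
  \<comment> \<open>The summand \<open>1\<close> makes room for the contribution \<open>\<pi> p / N\<close> to the first difference.\<close>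
  define M where "M = nat \<lceil>s / N\<rceil> + 1"
  have N0: "real N > 0" using N by simp
  have h: "0 < h" "h \<le> pi / 2" unfolding h_def using N by (auto simp: divide_simps)
  have \<theta>_h: "\<theta> k = 2 * h * k" "\<theta> (Suc k) = \<theta> k + 2 * h" for k
    unfolding \<theta>_def h_def using N0 by (simp_all add: field_simps)
  have sin_h: "h / 2 \<le> sin h" "sin h \<le> h"
    using half_le_sin[of h] sin_x_le_x[of h] h by simp_all
  have \<mu>_ge: "s / (real N)\<^sup>2 \<le> \<mu>"
  proof -
    have "2\<^sup>2 \<le> pi\<^sup>2" using pi_ge_two by (intro power_mono) auto
    hence "s * 4 \<le> s * pi\<^sup>2" using s by (intro mult_left_mono) auto
    hence "s / (real N)\<^sup>2 \<le> 8 * s * (h / 2)\<^sup>2"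
      unfolding h_def using N0 s by (simp add: power_divide power_mult_distrib divide_simps)
    also have "\<dots> \<le> \<mu>" unfolding \<mu>_def using sin_h h s by (intro mult_left_mono power_mono) auto
    finally show ?thesis .
  qed
  have \<mu>_le: "\<mu> \<le> 32"
  proof -
    have "\<mu> \<le> 8 * s * h\<^sup>2" unfolding \<mu>_def using sin_h h s by (intro mult_left_mono power_mono) auto
    also have "\<dots> \<le> 8 * (real N)\<^sup>2 * h\<^sup>2" using s by (intro mult_left_mono mult_right_mono) auto
    also have "\<dots> = 2 * pi\<^sup>2" unfolding h_def using N0 by (simp add: power_divide power_mult_distrib)
    also have "\<dots> \<le> 2 * 4\<^sup>2" using pi_less_4 by (intro mult_left_mono power_mono) auto
    finally show ?thesis by simp
  qed
  have "0 < s / (real N)\<^sup>2" using s N0 by simp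
  hence \<mu>0: "\<mu> > 0" using \<mu>_ge by linarith
  have \<delta>: "0 < \<delta>" "\<delta>\<^sup>2 = \<mu>" unfolding \<delta>_def using \<mu>0 by simp_all
  have \<delta>6: "\<delta> \<le> 6" unfolding \<delta>_def using \<mu>_le by (intro real_le_lsqrt) auto
  have \<delta>_ge: "1 / \<delta> \<le> N / sqrt s"
  proof -
    have "sqrt s / N = sqrt (s / (real N)\<^sup>2)" by (simp add: real_sqrt_divide)
    also have "\<dots> \<le> \<delta>" unfolding \<delta>_def using \<mu>_ge by simp
    finally have "1 / \<delta> \<le> 1 / (sqrt s / N)" using s N0 \<delta> by (intro divide_left_mono) auto
    thus ?thesis by simp
  qed
  have x: "\<phi> (Suc k) - \<phi> k = 2 * h * p - 4 * s * sin h * cos (\<theta> k + h)" for k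
  proof -
    have "sin (\<theta> (Suc k)) - sin (\<theta> k) = 2 * sin h * cos (\<theta> k + h)"
      unfolding \<theta>_h(2) by (rule sin_diff_step)
    moreover have "\<phi> (Suc k) - \<phi> k = p * (\<theta> (Suc k) - \<theta> k) - 2 * s * (sin (\<theta> (Suc k)) - sin (\<theta> k))"
      unfolding \<phi>_def by (simp add: algebra_simps)
    ultimately show ?thesis unfolding \<theta>_h(2) by simp
  qed
  have w: "(\<phi> (Suc (Suc k)) - \<phi> (Suc k)) - (\<phi> (Suc k) - \<phi> k) = \<mu> * sin (\<theta> (Suc k))" for k
  proof -
    have "cos (\<theta> k + h) - cos (\<theta> (Suc k) + h) = 2 * sin (\<theta> (Suc k)) * sin h"
      using cos_diff_step[of "\<theta> k + h" h] unfolding \<theta>_h(2) by (simp add: algebra_simps)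
    moreover have "(\<phi> (Suc (Suc k)) - \<phi> (Suc k)) - (\<phi> (Suc k) - \<phi> k)
        = 4 * s * sin h * (cos (\<theta> k + h) - cos (\<theta> (Suc k) + h))"
      unfolding x by (simp add: algebra_simps)
    ultimately show ?thesis unfolding \<mu>_def by (simp add: power2_eq_square)
  qed
  have sin_nonneg: "0 \<le> sin (\<theta> k)" if "k \<le> N" for k
    unfolding \<theta>_def using that N0 by (intro sin_ge_zero) (auto simp: divide_simps)
  have var: "\<bar>\<mu> * sin (\<theta> (Suc (Suc k))) - \<mu> * sin (\<theta> (Suc k))\<bar> \<le> \<mu> * (2 * h)" for k
  proof -
    have "sin (\<theta> (Suc k) + 2 * h) - sin (\<theta> (Suc k)) = 2 * sin h * cos (\<theta> (Suc k) + h)"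
      by (rule sin_diff_step)
    also have "\<bar>\<dots>\<bar> \<le> (2 * h) * 1"
      unfolding abs_mult using sin_h h by (intro mult_mono) auto
    finally have "\<mu> * \<bar>sin (\<theta> (Suc k) + 2 * h) - sin (\<theta> (Suc k))\<bar> \<le> \<mu> * (2 * h)"
      using \<mu>0 by (intro mult_left_mono) auto
    thus ?thesis
      unfolding \<theta>_h(2)[of "Suc k"] right_diff_distrib[symmetric] abs_mult using \<mu>0 by simp
  qed
  have M: "s / N \<le> real M - 1" "real M \<le> s / N + 2"
  proof -
    have "0 \<le> s / N" using s by simp
    hence "real M = of_int \<lceil>s / N\<rceil> + 1" unfolding M_def by simp
    thus "s / N \<le> real M - 1" "real M \<le> s / N + 2" by linarith+
  qed
  have range: "\<bar>2 * h * p - 4 * s * sin h * cos (\<theta> k + h)\<bar> \<le> 2 * pi * M" for k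
  proof -
    have "\<bar>2 * h * p\<bar> \<le> 2 * h * (2 * N)" unfolding abs_mult using p h by (intro mult_mono) auto
    also have "\<dots> = 2 * pi" unfolding h_def using N0 by simp
    finally have 1: "\<bar>2 * h * p\<bar> \<le> 2 * pi" .
    have "\<bar>4 * s * sin h * cos (\<theta> k + h)\<bar> \<le> 4 * s * h * 1"
      unfolding abs_mult using sin_h h s by (intro mult_mono) auto
    also have "\<dots> = 2 * pi * (s / N)" unfolding h_def by simp
    also have "\<dots> \<le> 2 * pi * (real M - 1)" using M by (intro mult_left_mono) auto
    finally have 2: "\<bar>4 * s * sin h * cos (\<theta> k + h)\<bar> \<le> 2 * pi * M - 2 * pi"
      by (simp add: algebra_simps)
    show ?thesis using 1 2 by linarith
  qed
  have "cmod (\<Sum>k<Suc n. of_real (\<mu> * sin (\<theta> (Suc k))) * cis (\<phi> (Suc k)))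
       \<le> 584 * pi * \<delta> * (2 * M + 1) + \<delta> + 4 * \<mu> / (2 * \<delta>)"
  proof (rule exponential_sum_second_difference_weight)
    show "\<phi> (Suc k) = \<phi> k + (2 * h * p - 4 * s * sin h * cos (\<theta> k + h))" for k
      using x[of k] by simp
    show "2 * h * p - 4 * s * sin h * cos (\<theta> (Suc k) + h)
        = (2 * h * p - 4 * s * sin h * cos (\<theta> k + h)) + \<mu> * sin (\<theta> (Suc k))" for k
      using w[of k] unfolding x by simp
    show "0 \<le> \<mu> * sin (\<theta> (Suc k)) \<and> \<mu> * sin (\<theta> (Suc k)) \<le> \<delta>\<^sup>2" if "k \<le> n" for k
      using sin_nonneg[of "Suc k"] that \<mu>0 mult_left_mono[OF sin_le_one, of \<mu> "\<theta> (Suc k)"]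
      by (simp add: n \<delta>(2))
    have "(\<Sum>k<n. \<bar>\<mu> * sin (\<theta> (Suc (Suc k))) - \<mu> * sin (\<theta> (Suc k))\<bar>) \<le> (\<Sum>k<n. \<mu> * (2 * h))"
      by (intro sum_mono var)
    also have "\<dots> = real n * (2 * h) * \<mu>" by simp
    also have "\<dots> \<le> real N * (2 * h) * \<mu>" using h \<mu>0 n by (intro mult_right_mono) auto
    also have "\<dots> = pi * \<mu>" unfolding h_def using N0 by simp
    also have "\<dots> \<le> 4 * \<mu>" using pi_less_4 \<mu>0 by (intro mult_right_mono) auto
    finally show "(\<Sum>k<n. \<bar>\<mu> * sin (\<theta> (Suc (Suc k))) - \<mu> * sin (\<theta> (Suc k))\<bar>) \<le> 4 * \<mu>" .
  qed (use \<delta> \<delta>6 range in auto)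
  also have "4 * \<mu> / (2 * \<delta>) = 2 * \<delta>" using \<delta> by (simp add: power2_eq_square flip: \<delta>(2))
  also have "584 * pi * \<delta> * (2 * M + 1) + \<delta> + 2 * \<delta> = \<delta> * (584 * pi * (2 * M + 1) + 3)"
    by (simp add: algebra_simps)
  also have "\<dots> \<le> \<delta> * (12000 * (1 + s / N))"
  proof (rule mult_left_mono)
    have "pi * real (2 * M + 1) \<le> 4 * (2 * (s / N + 2) + 1)"
      using pi_less_4 M s by (intro mult_mono) auto
    moreover have "0 \<le> s / N" using s by simp
    ultimately show "584 * pi * real (2 * M + 1) + 3 \<le> 12000 * (1 + s / N)"
      unfolding mult.assoc distrib_left by linarith
  qed (use \<delta> in simp)
  also have "(\<Sum>k<Suc n. of_real (\<mu> * sin (\<theta> (Suc k))) * cis (\<phi> (Suc k)))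
      = of_real \<mu> * (\<Sum>k<N. of_real (sin (\<theta> k)) * cis (\<phi> k))"
    unfolding n sum.lessThan_Suc_shift[of _ "Suc n"]
    by (simp add: \<theta>_def sum_distrib_left distrib_left mult.assoc)
  finally have "\<delta> * (\<delta> * cmod (\<Sum>k<N. of_real (sin (\<theta> k)) * cis (\<phi> k)))
      \<le> \<delta> * (12000 * (1 + s / N))"
    using \<mu>0 \<delta> by (simp add: norm_mult power2_eq_square flip: \<delta>(2))
  hence "\<delta> * cmod (\<Sum>k<N. of_real (sin (\<theta> k)) * cis (\<phi> k)) \<le> 12000 * (1 + s / N)"
    using \<delta>(1) by (simp only: mult_le_cancel_left_pos)
  hence "cmod (\<Sum>k<N. of_real (sin (\<theta> k)) * cis (\<phi> k)) \<le> 12000 * (1 + s / N) * (1 / \<delta>)"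
    using \<delta>(1) by (simp add: pos_le_divide_eq mult.commute)
  also have "\<dots> \<le> 12000 * (1 + s / N) * (N / sqrt s)"
    using \<delta>_ge s by (intro mult_left_mono) auto
  finally show ?thesis unfolding \<phi>_def .
qed

section \<open>The free wave on the ring\<close>

text \<open>
  The solution of \<open>P'' (m) = P (m - 1) - 2 P m + P (m + 1)\<close> on the ring of \<open>N\<close> sites that starts at
  rest from a unit mass at the origin, as a superposition of standing waves.
\<close>

definition ring_wave :: "nat \<Rightarrow> int \<Rightarrow> real \<Rightarrow> real" where
  "ring_wave N m s =
     (\<Sum>k<N. cos (2 * of_int m * (pi * real k / real N)) * cos (2 * s * sin (pi * real k / real N))) / N"

definition ring_wave_velocity :: "nat \<Rightarrow> int \<Rightarrow> real \<Rightarrow> real" where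
  "ring_wave_velocity N m s =
     (\<Sum>k<N. cos (2 * of_int m * (pi * real k / real N)) * (- (2 * sin (pi * real k / real N)) * sin (2 * s * sin (pi * real k / real N)))) / N"

lemma ring_wave_initial:
  assumes "N > 0"
  shows "ring_wave N m 0 = (if int N dvd m then 1 else 0)"
proof (cases "int N dvd m")
  case True
  then obtain q where q: "m = int N * q" by blast
  have "cos (2 * of_int m * (pi * real k / real N)) = 1" for k :: nat
  proof -
    have "2 * of_int m * (pi * real k / real N) = 2 * pi * of_int (q * int k)"
      using assms q by (simp add: field_simps)
    thus ?thesis by (simp only: cos_int_2pin)
  qed
  thus ?thesis using True assms by (simp add: ring_wave_def)
next
  case False
  define b where "b = pi * of_int m / N"
  have nz: "sin b \<noteq> 0"
  proof
    assume "sin b = 0"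
    then obtain i :: int where "b = of_int i * pi" unfolding sin_zero_iff_int2 by blast
    hence "of_int m = (of_int (i * int N) :: real)"
      using assms by (simp add: b_def field_simps)
    hence "m = i * int N" unfolding of_int_eq_iff .
    thus False using False by simp
  qed
  \<comment> \<open>Multiplied by \<open>2 sin b\<close>, the Dirichlet sum telescopes.\<close>
  have "2 * sin b * (\<Sum>k<N. cos (2 * of_int m * (pi * real k / real N)))
      = (\<Sum>k<N. sin ((2 * real (Suc k) - 1) * b) - sin ((2 * real k - 1) * b))"
    unfolding sum_distrib_left
  proof (intro sum.cong refl)
    fix k :: nat
    show "2 * sin b * cos (2 * of_int m * (pi * real k / real N))
        = sin ((2 * real (Suc k) - 1) * b) - sin ((2 * real k - 1) * b)"
      using sin_diff_step[of "(2 * real k - 1) * b" b] unfolding b_def by (simp add: algebra_simps)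
  qed
  also have "\<dots> = sin ((2 * real N - 1) * b) - sin ((2 * real 0 - 1) * b)"
    by (rule sum_lessThan_telescope)
  also have "(2 * real N - 1) * b = 2 * pi * of_int m - b"
    unfolding b_def using assms by (simp add: field_simps)
  also have "sin (2 * pi * of_int m - b) = - sin b"
    unfolding sin_diff by simp
  finally have "(\<Sum>k<N. cos (2 * of_int m * (pi * real k / real N))) = 0" using nz by simp
  thus ?thesis using False by (simp add: ring_wave_def)
qed

lemma ring_wave_velocity_initial: "ring_wave_velocity N m 0 = 0"
  by (simp add: ring_wave_velocity_def)

lemma ring_wave_periodic:
  assumes "N > 0"
  shows "ring_wave N (m + int N) s = ring_wave N m s"
proof -
  have "cos (2 * of_int (m + int N) * (pi * real k / real N)) = cos (2 * of_int m * (pi * real k / real N))" for k :: nat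
  proof -
    have "2 * of_int (m + int N) * (pi * real k / real N) = 2 * of_int m * (pi * real k / real N) + 2 * pi * of_int (int k)"
      using assms by (simp add: field_simps)
    thus ?thesis by (simp only: cos_add cos_int_2pin sin_int_2pin)
  qed
  thus ?thesis by (simp add: ring_wave_def)
qed

lemma ring_wave_has_derivative:
  "(ring_wave N m has_real_derivative ring_wave_velocity N m s) (at s)"
  unfolding ring_wave_def[abs_def] ring_wave_velocity_def
  by (auto intro!: derivative_eq_intros simp: sum_divide_distrib mult_ac)

lemma ring_wave_velocity_has_derivative:
  "(ring_wave_velocity N m has_real_derivative
      ring_wave N (m - 1) s - 2 * ring_wave N m s + ring_wave N (m + 1) s) (at s)"
proof -
  have "(ring_wave_velocity N m has_real_derivative
      (\<Sum>k<N. cos (2 * of_int m * (pi * real k / real N)) *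
        (- (4 * (sin (pi * real k / real N))\<^sup>2) * cos (2 * s * sin (pi * real k / real N)))) / N) (at s)"
    unfolding ring_wave_velocity_def[abs_def]
    by (auto intro!: derivative_eq_intros simp: sum_divide_distrib mult_ac power2_eq_square)
  moreover have "cos (2 * of_int (m - 1) * a) * c - 2 * (cos (2 * of_int m * a) * c)
      + cos (2 * of_int (m + 1) * a) * c = cos (2 * of_int m * a) * (- (4 * (sin a)\<^sup>2) * c)"
    for a c :: real
  proof -
    have "2 * of_int (m - 1) * a = 2 * of_int m * a - 2 * a"
      "2 * of_int (m + 1) * a = 2 * of_int m * a + 2 * a"
      by (simp_all add: algebra_simps)
    hence "cos (2 * of_int (m - 1) * a) = cos (2 * of_int m * a) * cos (2 * a) + sin (2 * of_int m * a) * sin (2 * a)"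
      "cos (2 * of_int (m + 1) * a) = cos (2 * of_int m * a) * cos (2 * a) - sin (2 * of_int m * a) * sin (2 * a)"
      by (simp_all only: cos_diff cos_add)
    moreover have "cos (2 * a) = 1 - 2 * (sin a)\<^sup>2" by (rule cos_double_sin)
    ultimately show ?thesis by (simp only:) (simp add: algebra_simps)
  qed
  hence "(\<Sum>k<N. cos (2 * of_int (m - 1) * (pi * real k / real N)) * cos (2 * s * sin (pi * real k / real N))
        - 2 * (cos (2 * of_int m * (pi * real k / real N)) * cos (2 * s * sin (pi * real k / real N)))
        + cos (2 * of_int (m + 1) * (pi * real k / real N)) * cos (2 * s * sin (pi * real k / real N)))
      = (\<Sum>k<N. cos (2 * of_int m * (pi * real k / real N)) *
          (- (4 * (sin (pi * real k / real N))\<^sup>2) * cos (2 * s * sin (pi * real k / real N))))"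
    by (intro sum.cong refl) (simp only:)
  hence "ring_wave N (m - 1) s - 2 * ring_wave N m s + ring_wave N (m + 1) s
      = (\<Sum>k<N. cos (2 * of_int m * (pi * real k / real N)) *
          (- (4 * (sin (pi * real k / real N))\<^sup>2) * cos (2 * s * sin (pi * real k / real N)))) / N"
    unfolding ring_wave_def sum.distrib sum_subtractf sum_distrib_left[symmetric]
    by (simp only: diff_divide_distrib[symmetric] add_divide_distrib[symmetric] times_divide_eq_right)
  ultimately show ?thesis by simp
qed

text \<open>
  The difference in \<open>m\<close> produces the factor \<open>sin \<theta>\<close> and the odd frequency \<open>2 m + 1\<close>; the product of this
  sine with the standing wave splits into the imaginary parts of two exponential sums, with frequencies
  \<open>p\<close> and \<open>- p\<close> and the same sign in front of \<open>2 s sin \<theta>\<close>.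
\<close>

lemma ring_wave_gradient_bound:
  assumes "N \<ge> 2" "0 < s" "s \<le> (real N)\<^sup>2" "\<bar>2 * m + 1\<bar> \<le> 2 * int N"
  shows "\<bar>ring_wave N (m + 1) s - ring_wave N m s\<bar> \<le> 24000 * (1 + s / N) / sqrt s"
proof -
  define S where "S p = (\<Sum>k<N. of_real (sin (pi * real k / real N)) * cis (p * (pi * real k / real N) - 2 * s * sin (pi * real k / real N)))"
    for p
  define p :: real where "p = of_int (2 * m + 1)"
  have "\<bar>p\<bar> = of_int \<bar>2 * m + 1\<bar>" unfolding p_def by simp
  also have "\<dots> \<le> of_int (2 * int N)" using assms(4) by (simp only: of_int_le_iff)
  finally have p: "\<bar>p\<bar> \<le> 2 * real N" by simp
  have S: "cmod (S q) \<le> 12000 * (1 + s / N) * (N / sqrt s)" if "\<bar>q\<bar> \<le> 2 * real N" for q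
    unfolding S_def using assms that by (intro sine_weighted_exponential_sum)
  have "cos (2 * of_int (m + 1) * a) * cos b - cos (2 * of_int m * a) * cos b
      = sin a * (sin (- p * a - b) - sin (p * a - b))"
    for a b :: real
  proof -
    have "cos (2 * of_int (m + 1) * a) - cos (2 * of_int m * a) = - (2 * sin (p * a) * sin a)"
      using cos_diff_step[of "2 * of_int m * a" a] unfolding p_def by (simp add: algebra_simps)
    moreover have "sin (- p * a - b) - sin (p * a - b) = - (2 * sin (p * a) * cos b)"
      unfolding sin_diff by simp
    ultimately show ?thesis unfolding left_diff_distrib[symmetric] by simp
  qed
  hence "(\<Sum>k<N. cos (2 * of_int (m + 1) * (pi * real k / real N)) * cos (2 * s * sin (pi * real k / real N))
        - cos (2 * of_int m * (pi * real k / real N)) * cos (2 * s * sin (pi * real k / real N)))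
      = Im (S (- p)) - Im (S p)"
    unfolding S_def Im_sum sum_subtractf[symmetric] by (intro sum.cong refl) (simp only:, simp add: right_diff_distrib)
  hence "(ring_wave N (m + 1) s - ring_wave N m s) * N = Im (S (- p)) - Im (S p)"
    unfolding ring_wave_def diff_divide_distrib[symmetric] sum_subtractf[symmetric]
    using assms(1) by simp
  hence "\<bar>ring_wave N (m + 1) s - ring_wave N m s\<bar> * N \<le> cmod (S (- p)) + cmod (S p)"
    using abs_Im_le_cmod[of "S (- p)"] abs_Im_le_cmod[of "S p"]
    by (metis (no_types, opaque_lifting) abs_mult abs_of_nat abs_triangle_ineq4 add_mono order_trans)
  also have "\<dots> \<le> 24000 * (1 + s / N) / sqrt s * N"
  proof -
    have "cmod (S (- p)) + cmod (S p) \<le> 2 * (12000 * (1 + s / N) * (N / sqrt s))"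
      using S[OF p] S[of "- p"] p unfolding abs_minus_cancel by linarith
    also have "\<dots> = 24000 * (1 + s / N) / sqrt s * N"
      by (simp add: field_simps)
    finally show ?thesis .
  qed
  finally show ?thesis using assms(1) by (simp only: mult_le_cancel_right)
qed

section \<open>The lattice solution\<close>

lemma at_within_atLeast_neq_bot:
  fixes t :: real
  assumes "t \<ge> 0"
  shows "at t within {0..} \<noteq> bot"
proof -
  have "at_right t \<le> at t within {0..}" using assms by (intro at_le) auto
  thus ?thesis using trivial_limit_at_right_real[of t] by (metis bot.extremum_unique)
qed

lemma zero_derivative_imp_constant:
  fixes f :: "real \<Rightarrow> real"
  assumes "\<And>t. t \<ge> 0 \<Longrightarrow> (f has_real_derivative 0) (at t within {0..})" "t \<ge> 0"
  shows "f t = f 0"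
proof (cases "t = 0")
  case False
  show ?thesis
  proof (rule DERIV_isconst_end[of 0 t f])
    show "0 < t" using False assms(2) by simp
    show "continuous_on {0..t} f"
      using DERIV_continuous_on[of "{0..}" f "\<lambda>_. 0"] assms(1) continuous_on_subset[of "{0..}" f "{0..t}"]
      by auto
    show "(f has_real_derivative 0) (at u)" if "0 < u" "u < t" for u
    proof -
      have "(f has_real_derivative 0) (at u within {0<..})"
        using assms(1)[of u] that by (auto intro: DERIV_subset)
      thus ?thesis using that by (simp add: at_within_open[of u "{0<..}"])
    qed
  qed
qed simp

text \<open>
  The energy \<open>E\<close> is conserved: after the equation is inserted, its derivative is a telescoping sum over
  one period, which vanishes by periodicity. The periodicity of \<open>v\<close> has to be derived from that of \<open>d\<close>;
  at time \<open>0\<close> this uses the uniqueness of one-sided derivatives.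
\<close>

lemma periodic_lattice_wave_unique:
  fixes d v a :: "int \<Rightarrow> real \<Rightarrow> real" and N :: nat
  assumes N: "N > 0" and c: "c \<ge> 0"
    and periodic: "\<And>n t. t \<ge> 0 \<Longrightarrow> d (n + int N) t = d n t"
    and d: "\<And>n t. t \<ge> 0 \<Longrightarrow> (d n has_real_derivative v n t) (at t within {0..})"
    and v: "\<And>n t. t \<ge> 0 \<Longrightarrow> (v n has_real_derivative a n t) (at t within {0..})"
    and wave: "\<And>n t. t \<ge> 0 \<Longrightarrow> a n t = c * (d (n - 1) t - 2 * d n t + d (n + 1) t)"
    and init: "\<And>n. d n 0 = 0" "\<And>n. v n 0 = 0"
    and t: "t \<ge> 0"
  shows "d n t = 0"
proof -
  define E where "E t = (\<Sum>k<N. (v (n + int k) t)\<^sup>2 + c * (d (n + int k + 1) t - d (n + int k) t)\<^sup>2)" for t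
  have v_periodic: "v (m + int N) t = v m t" if "t \<ge> 0" for m t
  proof (rule has_field_derivative_unique)
    show "(d m has_real_derivative v (m + int N) t) (at t within {0..})"
      by (rule has_field_derivative_transform_within[OF d[OF that, of "m + int N"], of 1])
         (use that periodic in auto)
    show "(d m has_real_derivative v m t) (at t within {0..})" by (rule d[OF that])
  qed (rule at_within_atLeast_neq_bot[OF that])
  have "(E has_real_derivative 0) (at t within {0..})" if t: "t \<ge> 0" for t
  proof -
    define D where "D k = d (n + int k) t - d (n + int k - 1) t" for k
    have "(E has_real_derivative
        (\<Sum>k<N. 2 * v (n + int k) t * a (n + int k) t
          + c * (2 * (d (n + int k + 1) t - d (n + int k) t) * (v (n + int k + 1) t - v (n + int k) t))))
        (at t within {0..})"
      unfolding E_def[abs_def]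
      by (auto intro!: derivative_eq_intros d[OF t] v[OF t] sum.cong simp: power2_eq_square algebra_simps)
    also have "(\<Sum>k<N. 2 * v (n + int k) t * a (n + int k) t
          + c * (2 * (d (n + int k + 1) t - d (n + int k) t) * (v (n + int k + 1) t - v (n + int k) t)))
        = (\<Sum>k<N. 2 * c * (v (n + int (Suc k)) t * D (Suc k)) - 2 * c * (v (n + int k) t * D k))"
      unfolding wave[OF t] D_def by (intro sum.cong refl) (simp add: algebra_simps)
    also have "\<dots> = 2 * c * (v (n + int N) t * D N) - 2 * c * (v (n + int 0) t * D 0)"
      by (rule sum_lessThan_telescope)
    also have "D N = D 0"
      using periodic[OF t, of n] periodic[OF t, of "n - 1"] by (simp add: D_def algebra_simps)
    finally show ?thesis by (simp add: v_periodic[OF t])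
  qed
  hence E0: "E t = 0" if "t \<ge> 0" for t
    using zero_derivative_imp_constant[of E t] that by (simp add: E_def init)
  have "v n t = 0" if "t \<ge> 0" for t
  proof -
    have "(v (n + int 0) t)\<^sup>2 + c * (d (n + int 0 + 1) t - d (n + int 0) t)\<^sup>2 \<le> E t"
      unfolding E_def by (rule member_le_sum) (use N c in auto)
    hence "(v n t)\<^sup>2 + c * (d (n + 1) t - d n t)\<^sup>2 \<le> 0" using E0[OF that] by simp
    moreover have "c * (d (n + 1) t - d n t)\<^sup>2 \<ge> 0" using c by simp
    ultimately have "(v n t)\<^sup>2 \<le> 0" by linarith
    thus ?thesis by simp
  qed
  hence "d n t = d n 0" using d[of _ n] t by (intro zero_derivative_imp_constant) auto
  thus ?thesis by (simp add: init)
qed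

text \<open>
  Since \<open>ring_wave N m 0\<close> is the unit mass on the ring, this is the second difference of the unit mass
  at \<open>N / 2\<close>. For \<open>N \<ge> 4\<close> the three sites of its support are distinct modulo \<open>N\<close>.
\<close>

lemma ghost_force_eq_laplacian:
  assumes "N \<ge> 4"
  shows "ghost_force \<kappa> (int N) n = - \<kappa> * N *
    (ring_wave N (n - int N div 2 - 1) 0 - 2 * ring_wave N (n - int N div 2) 0
      + ring_wave N (n - int N div 2 + 1) 0)"
proof -
  define m where "m = n - int N div 2"
  have dvd: "n mod int N = r \<longleftrightarrow> int N dvd n - r" if "0 \<le> r" "r < int N" for r
    using mod_eq_dvd_iff[of n "int N" r] that by simp
  have iff: "n mod int N = int N div 2 \<longleftrightarrow> int N dvd m"
    "n mod int N = int N div 2 - 1 \<longleftrightarrow> int N dvd m + 1"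
    "n mod int N = int N div 2 + 1 \<longleftrightarrow> int N dvd m - 1"
    using assms by (subst dvd; simp add: m_def algebra_simps)+
  have small: "\<not> int N dvd 1" "\<not> int N dvd 2"
    using assms zdvd_imp_le[of "int N" 1] zdvd_imp_le[of "int N" 2] by auto
  have excl: "\<not> (int N dvd m \<and> int N dvd m + 1)" "\<not> (int N dvd m \<and> int N dvd m - 1)"
    "\<not> (int N dvd m + 1 \<and> int N dvd m - 1)"
    using small dvd_diff[of "int N" "m + 1" m] dvd_diff[of "int N" m "m - 1"]
      dvd_diff[of "int N" "m + 1" "m - 1"] by auto
  have N0: "N > 0" using assms by simp
  show ?thesis
    unfolding ghost_force_def Let_def iff m_def[symmetric] ring_wave_initial[OF N0]
    using excl by auto
qed

text \<open>
  The right-hand side solves the same initial value problem: its stationary part balances the ghost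
  force, and its second part is a free wave in the rescaled time \<open>\<sigma> t\<close>, with \<open>\<sigma>\<^sup>2 = K N\<^sup>2\<close>, that cancels
  the stationary part initially. The difference of the two solutions is a free wave with zero initial
  data.
\<close>

lemma lattice_solution_eq_ring_wave:
  assumes K: "\<kappa>1 + 4 * \<kappa>2 > 0" and N: "N \<ge> 4"
    and sol: "lattice_solution \<kappa>1 \<kappa>2 (int N) y" and t: "t \<ge> 0"
  shows "y n t = \<kappa>2 / ((\<kappa>1 + 4 * \<kappa>2) * N) *
    (ring_wave N (n - int N div 2) 0
      - ring_wave N (n - int N div 2) (sqrt (\<kappa>1 + 4 * \<kappa>2) * N * t))"
proof -
  define K where "K = \<kappa>1 + 4 * \<kappa>2"
  define \<alpha> where "\<alpha> = \<kappa>2 / (K * N)"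
  define \<sigma> where "\<sigma> = sqrt K * N"
  define P where "P m s = ring_wave N (m - int N div 2) s" for m s
  define Q where "Q m s = ring_wave_velocity N (m - int N div 2) s" for m s
  have N0: "N > 0" using N by simp
  have \<sigma>2: "\<sigma>\<^sup>2 = K * (real N)\<^sup>2" unfolding \<sigma>_def K_def using K by (simp add: power_mult_distrib)
  have \<alpha>\<sigma>: "\<alpha> * \<sigma>\<^sup>2 = \<kappa>2 * N"
    unfolding \<sigma>2 \<alpha>_def using K N0 by (simp add: K_def power2_eq_square)
  obtain v a where va:
    "\<forall>n. \<forall>t\<ge>0. (y n has_real_derivative v n t) (at t within {0..}) \<and>
        (v n has_real_derivative a n t) (at t within {0..}) \<and>
        a n t - K / (1 / real_of_int (int N))\<^sup>2 * (y (n - 1) t - 2 * y n t + y (n + 1) t)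
          = ghost_force \<kappa>2 (int N) n"
    and init: "\<And>n. y n 0 = 0 \<and> v n 0 = 0"
    and per: "\<And>n t. t \<ge> 0 \<Longrightarrow> y (n + int N) t = y n t"
    using sol unfolding lattice_solution_def Let_def K_def[symmetric] by blast
  have y_deriv: "(y n has_real_derivative v n t) (at t within {0..})"
    and v_deriv: "(v n has_real_derivative a n t) (at t within {0..})" if "t \<ge> 0" for n t
    using va that by blast+
  have wave: "a n t = K * (real N)\<^sup>2 * (y (n - 1) t - 2 * y n t + y (n + 1) t)
      + ghost_force \<kappa>2 (int N) n" if "t \<ge> 0" for n t
  proof -
    have "a n t - K / (1 / real_of_int (int N))\<^sup>2 * (y (n - 1) t - 2 * y n t + y (n + 1) t)
        = ghost_force \<kappa>2 (int N) n"
      using va that by blast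
    thus ?thesis by (simp add: power_divide)
  qed
  have P_deriv: "(P m has_real_derivative Q m s) (at s)" for m s
    unfolding P_def[abs_def] Q_def by (rule ring_wave_has_derivative)
  have Q_deriv: "(Q m has_real_derivative P (m - 1) s - 2 * P m s + P (m + 1) s) (at s)" for m s
    using ring_wave_velocity_has_derivative[of N "m - int N div 2" s]
    unfolding P_def[abs_def] Q_def[abs_def] by (simp add: algebra_simps)
  have scale: "((\<lambda>t. f (\<sigma> * t)) has_real_derivative f' * \<sigma>) (at t within {0..})"
    if "(f has_real_derivative f') (at (\<sigma> * t))" for f f' t
    using that by (intro DERIV_chain'[where g = f]) (auto intro!: derivative_eq_intros)
  have "y n t - \<alpha> * (P n 0 - P n (\<sigma> * t)) = 0"
  proof (rule periodic_lattice_wave_unique[where N = N and c = "K * (real N)\<^sup>2"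
        and d = "\<lambda>n t. y n t - \<alpha> * (P n 0 - P n (\<sigma> * t))"
        and v = "\<lambda>n t. v n t + \<alpha> * (Q n (\<sigma> * t) * \<sigma>)"
        and a = "\<lambda>n t. a n t + \<alpha> * ((P (n - 1) (\<sigma> * t) - 2 * P n (\<sigma> * t) + P (n + 1) (\<sigma> * t)) * \<sigma> * \<sigma>)"])
    show "y (n + int N) t - \<alpha> * (P (n + int N) 0 - P (n + int N) (\<sigma> * t))
        = y n t - \<alpha> * (P n 0 - P n (\<sigma> * t))" if "t \<ge> 0" for n t
      using per[OF that] ring_wave_periodic[OF N0, of "n - int N div 2"]
      by (simp add: P_def algebra_simps)
    show "((\<lambda>t. y n t - \<alpha> * (P n 0 - P n (\<sigma> * t))) has_real_derivative
        v n t + \<alpha> * (Q n (\<sigma> * t) * \<sigma>)) (at t within {0..})" if "t \<ge> 0" for n t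
      by (auto intro!: derivative_eq_intros y_deriv[OF that] scale[OF P_deriv])
    show "((\<lambda>t. v n t + \<alpha> * (Q n (\<sigma> * t) * \<sigma>)) has_real_derivative
        a n t + \<alpha> * ((P (n - 1) (\<sigma> * t) - 2 * P n (\<sigma> * t) + P (n + 1) (\<sigma> * t)) * \<sigma> * \<sigma>))
        (at t within {0..})" if "t \<ge> 0" for n t
      by (auto intro!: derivative_eq_intros v_deriv[OF that] scale[OF Q_deriv])
    show "a n t + \<alpha> * ((P (n - 1) (\<sigma> * t) - 2 * P n (\<sigma> * t) + P (n + 1) (\<sigma> * t)) * \<sigma> * \<sigma>)
        = K * (real N)\<^sup>2 * ((y (n - 1) t - \<alpha> * (P (n - 1) 0 - P (n - 1) (\<sigma> * t)))
          - 2 * (y n t - \<alpha> * (P n 0 - P n (\<sigma> * t)))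
          + (y (n + 1) t - \<alpha> * (P (n + 1) 0 - P (n + 1) (\<sigma> * t))))" if "t \<ge> 0" for n t
    proof -
      have "ghost_force \<kappa>2 (int N) n = - (\<alpha> * \<sigma>\<^sup>2) * (P (n - 1) 0 - 2 * P n 0 + P (n + 1) 0)"
        unfolding \<alpha>\<sigma> ghost_force_eq_laplacian[OF N] P_def by (simp add: algebra_simps)
      thus ?thesis
        unfolding wave[OF that] \<sigma>2[symmetric] by (simp add: algebra_simps power2_eq_square)
    qed
    show "K * (real N)\<^sup>2 \<ge> 0" using K by (simp add: K_def)
  qed (use N0 init t in \<open>auto simp: Q_def ring_wave_velocity_initial\<close>)
  thus ?thesis unfolding \<alpha>_def \<sigma>_def P_def K_def by simp
qed

section \<open>The gradient estimate\<close>

theorem theorem5p15: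
  fixes \<kappa>1 \<kappa>2 :: real
  assumes "\<kappa>1 + 4 * \<kappa>2 > 0"
  shows "\<exists>C::real. C > 0 \<and>
    (\<forall>(N::int) (y :: int \<Rightarrow> real \<Rightarrow> real) (t::real) (n::int).
       let \<epsilon> = 1 / real_of_int N; \<gamma> = t * sqrt (\<kappa>1 + 4 * \<kappa>2) in
       even N \<longrightarrow> N \<ge> 4 \<longrightarrow> lattice_solution \<kappa>1 \<kappa>2 N y \<longrightarrow>
       t > 0 \<longrightarrow> 1 \<le> \<gamma> \<longrightarrow> \<gamma> \<le> real_of_int N \<longrightarrow>
       n \<in> {1..N} \<longrightarrow> n \<noteq> N div 2 \<longrightarrow> n \<noteq> N div 2 - 1 \<longrightarrow>
       \<bar>discrete_gradient N y n t\<bar>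
         \<le> C * (\<bar>\<kappa>2\<bar> / (\<kappa>1 + 4 * \<kappa>2)) *
            (sqrt (\<epsilon> / \<gamma>) * (1 + \<gamma>) + \<epsilon> * (1 + \<epsilon> * \<gamma> + ln (\<gamma> + 2))))"
proof (intro exI[of _ 24000] conjI allI; (unfold Let_def, intro impI)?)
  fix N :: int and y :: "int \<Rightarrow> real \<Rightarrow> real" and t :: real and n :: int
  define K where "K = \<kappa>1 + 4 * \<kappa>2"
  define \<gamma> where "\<gamma> = t * sqrt K"
  assume N: "N \<ge> 4" and sol: "lattice_solution \<kappa>1 \<kappa>2 N y" and t: "t > 0"
    and \<gamma>1: "1 \<le> t * sqrt (\<kappa>1 + 4 * \<kappa>2)" and \<gamma>N: "t * sqrt (\<kappa>1 + 4 * \<kappa>2) \<le> real_of_int N"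
    and n: "n \<in> {1..N}" "n \<noteq> N div 2" "n \<noteq> N div 2 - 1"
  note \<gamma> = \<gamma>1[folded K_def, folded \<gamma>_def] \<gamma>N[folded K_def, folded \<gamma>_def]
  obtain L :: nat where L: "N = int L" using N by (metis nonneg_int_cases order_trans zero_le_numeral)
  define m where "m = n - N div 2"
  define s where "s = real L * \<gamma>"
  have L4: "L \<ge> 4" using N L by simp
  have L0: "L > 0" "real L > 0" using L4 by simp_all
  have K0: "K > 0" using assms by (simp add: K_def)
  have m: "m \<noteq> 0" "m + 1 \<noteq> 0" "\<bar>m\<bar> < N" "\<bar>m + 1\<bar> < N" "\<bar>2 * m + 1\<bar> \<le> 2 * N"
    unfolding m_def using n N by auto
  have s: "0 < s" "s \<le> (real L)\<^sup>2" "s / L = \<gamma>"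
    unfolding s_def using \<gamma> L L0 by (simp_all add: power2_eq_square)
  have zero: "ring_wave L m 0 = 0" "ring_wave L (m + 1) 0 = 0"
    unfolding ring_wave_initial[OF L0(1)] using m L
    by (auto dest: zdvd_not_zless dest!: dvd_imp_le_int)
  have y: "y (m + N div 2) t = \<kappa>2 / (K * L) * (ring_wave L m 0 - ring_wave L m s)" for m
  proof -
    have "sqrt K * real L * t = s" by (simp add: s_def \<gamma>_def mult_ac)
    thus ?thesis
      using lattice_solution_eq_ring_wave[of \<kappa>1 \<kappa>2 L y t "m + N div 2"] assms L4 sol t L
      by (simp add: K_def)
  qed
  have "discrete_gradient N y n t = L * (y ((m + 1) + N div 2) t - y (m + N div 2) t)"
    unfolding discrete_gradient_def Let_def m_def by (simp add: L)
  also have "\<dots> = - (\<kappa>2 / K) * (ring_wave L (m + 1) s - ring_wave L m s)"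
    unfolding y zero using L0 K0 by (simp add: field_simps)
  finally have "\<bar>discrete_gradient N y n t\<bar>
      = \<bar>\<kappa>2\<bar> / K * \<bar>ring_wave L (m + 1) s - ring_wave L m s\<bar>"
    using K0 by (simp add: abs_mult)
  also have "\<dots> \<le> \<bar>\<kappa>2\<bar> / K * (24000 * (1 + s / L) / sqrt s)"
    using K0 L4 s m L by (intro mult_left_mono ring_wave_gradient_bound) auto
  also have "\<dots> = 24000 * (\<bar>\<kappa>2\<bar> / K) * (sqrt ((1 / N) / \<gamma>) * (1 + \<gamma>))"
    unfolding s(3) by (simp add: s_def L real_sqrt_divide real_sqrt_mult)
  also have "\<dots> \<le> 24000 * (\<bar>\<kappa>2\<bar> / K) * (sqrt ((1 / N) / \<gamma>) * (1 + \<gamma>)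
      + 1 / N * (1 + 1 / N * \<gamma> + ln (\<gamma> + 2)))"
    using K0 \<gamma> N by (intro mult_left_mono) auto
  finally show "\<bar>discrete_gradient N y n t\<bar>
      \<le> 24000 * (\<bar>\<kappa>2\<bar> / (\<kappa>1 + 4 * \<kappa>2)) *
        (sqrt (1 / real_of_int N / (t * sqrt (\<kappa>1 + 4 * \<kappa>2))) * (1 + t * sqrt (\<kappa>1 + 4 * \<kappa>2))
         + 1 / real_of_int N * (1 + 1 / real_of_int N * (t * sqrt (\<kappa>1 + 4 * \<kappa>2))
           + ln (t * sqrt (\<kappa>1 + 4 * \<kappa>2) + 2)))"
    unfolding \<gamma>_def K_def .
qed simp

end
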